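(* Let $F:\mathbb{Z}^2\to I^3$ be an isotropic V-net, infinitesimally flexible with velocity diagram $V$. Then the nets of the Darboux wreath defined by $F$ have the following properties: (i) $F$ and $LV$ are isotropic V-nets with the same top view, related by the metric dual of Kœnigs duality. (ii) The isotropic dihedral angle along each parameter line of $F$ and of $LV$ is constant. (iii) The nets $LB=\nu(F)$ and $\bar C=\nu(LV)$ are translational nets and they are Combescure transforms of each other. Moreover they are related by Kœnigs duality, and their top views are reciprocal diagrams to the top views of $F$ and $LV$. (iv) The nets $LC$ and $\bar B$ of the wreath are reciprocal parallel to $F$ and $LV$, respectively. They are isotropic K-nets, i.e. discrete surfaces of constant isotropic Gaussian curvature: $LC$ and $\bar B$ are A-nets and isotropic Chebyshev nets, since they appear as translational nets in the top view, these top views being the same as the top views of $\bar C$ and $LB$, respectively.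
   Context: $I^3$ is $\mathbb{R}^3$; the top view of $(x,y,z)$ is $(x,y)$; $L(x,y,z)=(y,-x,-z)$. The isotropic angle of planes $z=u_ix+v_iy+w_i$ ($i=1,2$) is $\sqrt{(u_1-u_2)^2+(v_1-v_2)^2}$. A discrete net is a map $F:\mathbb{Z}^2\to\mathbb{R}^3$ with faces $\mathfrak f_{ij}=F_{ij}F_{i+1,j}F_{i+1,j+1}F_{i,j+1}$. A Q-net has planar faces; an A-net has planar vertex stars (each vertex is coplanar with its four neighbours). Face planes are assumed not parallel to the $z$-axis and faces non-degenerate. An isotropic V-net is a Q-net all of whose parameter lines appear as straight lines in the top view. A translational net is a net of the form $G_{ij}=g_i+h_j$ (all faces parallelograms). Two nets are Combescure transforms of each other if corresponding edges are parallel. An isotropic Chebyshev net has, in the top view, equal opposite edge lengths in each face; an isotropic K-net is an A-net whose top view is a translational net. Metric duality $\nu$: point $(a,b,w)\leftrightarrow$ plane $bx-ay+z-w=0$. For a Q-net $G$ with face planes $\pi_{ij}$, $\nu(G)$ has vertices $\nu(\pi_{ij})$ indexed by faces of $G$; its face corresponding to $G_{ij}$ is $\nu(\pi_{i-1,j-1}),\nu(\pi_{i,j-1}),\nu(\pi_{ij}),\nu(\pi_{i-1,j})$. For an A-net $G$ with vertex-star planes $\alpha_{ij}$, $\nu(G)$ is the net with vertices $\nu(\alpha_{ij})$, with the same indexing as $G$. Infinitesimal flexibility: a Q-net $F$ is infinitesimally flexible with velocity diagram $V:\mathbb{Z}^2\to\mathbb{R}^3$ if (a) $LV$ and $F$ have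 the same top view; (b) corresponding faces of $\nu(F)$ and $\nu(LV)$ have top views with vanishing mixed area, where the mixed area of quadrilaterals $P,Q\subset\mathbb{R}^2$ is $\frac14\sum_{k=1}^4(\det(p_k,q_{k+1})+\det(q_k,p_{k+1}))$; (c) for each face $\mathfrak f$ there are $\bar D_{\mathfrak f}\in\mathbb{R}^3$ and $T_{\mathfrak f}=\begin{pmatrix}0&c_3&0\\-c_3&0&0\\c_1&c_2&0\end{pmatrix}$ with $V_{kl}=\bar D_{\mathfrak f}+T_{\mathfrak f}F_{kl}$ for each vertex $F_{kl}$ of $\mathfrak f$. It is assumed non-trivial and non-degenerate: all edges of $\nu(F)$, $\nu(LV)$ have non-zero length. Reciprocal parallel: a net $G$ whose vertices correspond to the faces of $F$ is reciprocal parallel to $F$ if, for any two faces $\mathfrak f,\mathfrak g$ of $F$ sharing an edge, the edge $G_{\mathfrak f}G_{\mathfrak g}$ is parallel to that shared edge. Planar nets in this relation are called reciprocal diagrams. Kœnigs duality of two Q-nets: corresponding faces $p_1p_2p_3p_4$, $q_1q_2q_3q_4$ have parallel corresponding edges and parallel non-corresponding diagonals ($p_1p_3\parallel q_2q_4$, $p_2p_4\parallel q_1q_3$). Two Q-nets are related by the metric dual of Kœnigs duality if their $\nu$-images are related by Kœnigs duality. Isotropic dihedral angle along a parameter line: for the edges of one parameter line, the isotropic angle of the two face planes adjacent to the edge; constant means that it is the same for all edges of that parameter line. Nets of the Darboux wreath: $F$, $LV$, $LB=\nu(F)$, $\bar C=\nu(LV)$, the A-net $LC$ that is reciprocal parallel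 to $F$ and has the same top view as $\bar C$ (such a net exists for every infinitesimally flexible Q-net $F$), and $\bar B=\nu(LC)$. Here $LC$ and $\bar B$ have vertices indexed by the faces of $F$. *)

theory Defs
  imports "HOL-Analysis.Analysis"
begin

type_synonym 'a net = "int \<Rightarrow> int \<Rightarrow> 'a"

definition top_view :: "real^3 \<Rightarrow> real^2" where
  "top_view p = vector [p$1, p$2]"

definition top_net :: "(real^3) net \<Rightarrow> (real^2) net" where
  "top_net F = (\<lambda>i j. top_view (F i j))"

definition L :: "real^3 \<Rightarrow> real^3" where
  "L p = vector [p$2, - p$1, - p$3]"

definition L_net :: "(real^3) net \<Rightarrow> (real^3) net" where
  "L_net V = (\<lambda>i j. L (V i j))"

text \<open>The planes \<open>z = u x + v y + w\<close> are exactly the planes not parallel to the \<open>z\<close>-axis.\<close>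

definition graph_plane :: "real \<Rightarrow> real \<Rightarrow> real \<Rightarrow> (real^3) set" where
  "graph_plane u v w = {p. p$3 = u * p$1 + v * p$2 + w}"

definition non_vertical_plane :: "(real^3) set \<Rightarrow> bool" where
  "non_vertical_plane P \<longleftrightarrow> (\<exists>u v w. P = graph_plane u v w)"

text \<open>The coefficients of a non-vertical plane are unique, so the angle is well defined there.\<close>

definition isotropic_angle :: "(real^3) set \<Rightarrow> (real^3) set \<Rightarrow> real" where
  "isotropic_angle P Q = (THE t. \<exists>u1 v1 w1 u2 v2 w2.
     P = graph_plane u1 v1 w1 \<and> Q = graph_plane u2 v2 w2 \<and>
     t = sqrt ((u1 - u2)^2 + (v1 - v2)^2))"

text \<open>Being parallel is a relation between non-zero vectors here: edges and diagonals
  that are said to be parallel are in particular non-degenerate.\<close>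

definition parallel :: "'a::real_vector \<Rightarrow> 'a \<Rightarrow> bool" where
  "parallel a b \<longleftrightarrow> a \<noteq> 0 \<and> b \<noteq> 0 \<and> collinear {0, a, b}"

text \<open>Vertices of the face \<open>(i, j)\<close> in cyclic order, for \<open>k = 0, 1, 2, 3\<close>.\<close>

definition corner :: "'a net \<Rightarrow> int \<Rightarrow> int \<Rightarrow> nat \<Rightarrow> 'a" where
  "corner F i j k = [F i j, F (i+1) j, F (i+1) (j+1), F i (j+1)] ! k"

definition face_plane :: "(real^3) net \<Rightarrow> int \<Rightarrow> int \<Rightarrow> (real^3) set" where
  "face_plane F i j = affine hull (corner F i j ` {..<4})"

definition star_plane :: "(real^3) net \<Rightarrow> int \<Rightarrow> int \<Rightarrow> (real^3) set" where
  "star_plane G i j =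
     affine hull {G i j, G (i+1) j, G (i-1) j, G i (j+1), G i (j-1)}"

definition nondegenerate_face :: "(real^3) net \<Rightarrow> int \<Rightarrow> int \<Rightarrow> bool" where
  "nondegenerate_face F i j \<longleftrightarrow>
     (\<forall>k<4. \<not> collinear {corner F i j k, corner F i j ((k+1) mod 4), corner F i j ((k+2) mod 4)})"

text \<open>Planarity is expressed by the affine hull of the vertices being a plane; the standing
  assumptions (planes not parallel to the \<open>z\<close>-axis, non-degenerate faces) are part of
  the definitions.\<close>

definition Q_net :: "(real^3) net \<Rightarrow> bool" where
  "Q_net F \<longleftrightarrow> (\<forall>i j. non_vertical_plane (face_plane F i j) \<and> nondegenerate_face F i j)"

definition A_net :: "(real^3) net \<Rightarrow> bool" where
  "A_net G \<longleftrightarrow> (\<forall>i j. non_vertical_plane (star_plane G i j))"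

definition isotropic_V_net :: "(real^3) net \<Rightarrow> bool" where
  "isotropic_V_net F \<longleftrightarrow> Q_net F \<and>
     (\<forall>i. collinear (range (\<lambda>j. top_net F i j))) \<and>
     (\<forall>j. collinear (range (\<lambda>i. top_net F i j)))"

definition translational_net :: "('a::real_vector) net \<Rightarrow> bool" where
  "translational_net G \<longleftrightarrow> (\<exists>g h. \<forall>i j. G i j = g i + h j)"

definition combescure :: "('a::real_vector) net \<Rightarrow> 'a net \<Rightarrow> bool" where
  "combescure G H \<longleftrightarrow> (\<forall>i j.
     parallel (G (i+1) j - G i j) (H (i+1) j - H i j) \<and>
     parallel (G i (j+1) - G i j) (H i (j+1) - H i j))"

definition isotropic_Chebyshev_net :: "(real^3) net \<Rightarrow> bool" where
  "isotropic_Chebyshev_net F \<longleftrightarrow> (\<forall>i j.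
     dist (top_net F i j) (top_net F (i+1) j) = dist (top_net F i (j+1)) (top_net F (i+1) (j+1)) \<and>
     dist (top_net F i j) (top_net F i (j+1)) = dist (top_net F (i+1) j) (top_net F (i+1) (j+1)))"

definition isotropic_K_net :: "(real^3) net \<Rightarrow> bool" where
  "isotropic_K_net G \<longleftrightarrow> A_net G \<and> translational_net (top_net G)"

text \<open>The faces \<open>(i-1, j)\<close> and \<open>(i, j)\<close> of \<open>F\<close> share the edge from \<open>F i j\<close> to \<open>F i (j+1)\<close>;
  the faces \<open>(i, j-1)\<close> and \<open>(i, j)\<close> share the edge from \<open>F i j\<close> to \<open>F (i+1) j\<close>.\<close>

definition reciprocal_parallel :: "('a::real_vector) net \<Rightarrow> 'a net \<Rightarrow> bool" where
  "reciprocal_parallel G F \<longleftrightarrow> (\<forall>i j.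
     parallel (G i j - G (i-1) j) (F i (j+1) - F i j) \<and>
     parallel (G i j - G i (j-1)) (F (i+1) j - F i j))"

definition reciprocal_diagram :: "(real^2) net \<Rightarrow> (real^2) net \<Rightarrow> bool" where
  "reciprocal_diagram G F \<longleftrightarrow> reciprocal_parallel G F"

definition Koenigs_dual :: "(real^3) net \<Rightarrow> (real^3) net \<Rightarrow> bool" where
  "Koenigs_dual G H \<longleftrightarrow> Q_net G \<and> Q_net H \<and> (\<forall>i j.
     (\<forall>k<4. parallel (corner G i j ((k+1) mod 4) - corner G i j k)
                     (corner H i j ((k+1) mod 4) - corner H i j k)) \<and>
     parallel (corner G i j 2 - corner G i j 0) (corner H i j 3 - corner H i j 1) \<and>
     parallel (corner G i j 3 - corner G i j 1) (corner H i j 2 - corner H i j 0))"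

definition dihedral_angles_constant :: "(real^3) net \<Rightarrow> bool" where
  "dihedral_angles_constant F \<longleftrightarrow>
     (\<forall>i. \<exists>c. \<forall>j. isotropic_angle (face_plane F (i-1) j) (face_plane F i j) = c) \<and>
     (\<forall>j. \<exists>c. \<forall>i. isotropic_angle (face_plane F i (j-1)) (face_plane F i j) = c)"

definition nu_point :: "real^3 \<Rightarrow> (real^3) set" where
  "nu_point p = {q. p$2 * q$1 - p$1 * q$2 + q$3 - p$3 = 0}"

text \<open>\<^const>\<open>nu_point\<close> is injective with range the non-vertical planes.\<close>

definition nu_plane :: "(real^3) set \<Rightarrow> real^3" where
  "nu_plane P = (THE p. nu_point p = P)"

text \<open>For a Q-net \<open>F\<close>, the vertex \<open>(i, j)\<close> of the dual net comes from the face \<open>(i, j)\<close> of \<open>F\<close>, and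
  its face with vertices \<open>(i-1, j-1), (i, j-1), (i, j), (i-1, j)\<close> corresponds to \<open>F i j\<close>.\<close>

definition nu_Q :: "(real^3) net \<Rightarrow> (real^3) net" where
  "nu_Q F = (\<lambda>i j. nu_plane (face_plane F i j))"

definition nu_A :: "(real^3) net \<Rightarrow> (real^3) net" where
  "nu_A G = (\<lambda>i j. nu_plane (star_plane G i j))"

definition metric_dual_Koenigs :: "(real^3) net \<Rightarrow> (real^3) net \<Rightarrow> bool" where
  "metric_dual_Koenigs F G \<longleftrightarrow> Q_net F \<and> Q_net G \<and> Koenigs_dual (nu_Q F) (nu_Q G)"

definition mixed_area :: "(nat \<Rightarrow> real^2) \<Rightarrow> (nat \<Rightarrow> real^2) \<Rightarrow> real" where
  "mixed_area p q = 1/4 * (\<Sum>k<4.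
     det (vector [p k, q ((k+1) mod 4)] :: real^2^2) +
     det (vector [q k, p ((k+1) mod 4)] :: real^2^2))"

definition isotropic_velocity_matrix :: "real \<Rightarrow> real \<Rightarrow> real \<Rightarrow> real^3^3" where
  "isotropic_velocity_matrix c1 c2 c3 =
     vector [vector [0, c3, 0], vector [- c3, 0, 0], vector [c1, c2, 0]]"

definition edges_nonzero :: "'a net \<Rightarrow> bool" where
  "edges_nonzero G \<longleftrightarrow> (\<forall>i j. G (i+1) j \<noteq> G i j \<and> G i (j+1) \<noteq> G i j)"

text \<open>That the dual nets have no edges of length zero also excludes trivial velocity diagrams: if \<open>V\<close> is an infinitesimal isotropic motion of all
  of \<open>F\<close>, the faces of \<open>L V\<close> lie in one plane and the dual of \<open>L V\<close> is a single point.\<close>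

definition infinitesimally_flexible :: "(real^3) net \<Rightarrow> (real^3) net \<Rightarrow> bool" where
  "infinitesimally_flexible F V \<longleftrightarrow>
     Q_net F \<and>
     top_net (L_net V) = top_net F \<and>
     (\<forall>i j. mixed_area (corner (top_net (nu_Q F)) i j)
                       (corner (top_net (nu_Q (L_net V))) i j) = 0) \<and>
     (\<forall>i j. \<exists>D c1 c2 c3. \<forall>k<4.
        corner V i j k = D + isotropic_velocity_matrix c1 c2 c3 *v corner F i j k) \<and>
     edges_nonzero (nu_Q F) \<and> edges_nonzero (nu_Q (L_net V))"

text \<open>The nets \<open>F\<close>, \<open>LV\<close>, \<open>LB\<close>, \<open>Cbar\<close>, \<open>LC\<close>, \<open>Bbar\<close> of the wreath. It is a relation since
  \<open>LC\<close> is determined by the conditions only up to a translation in \<open>z\<close>-direction.\<close>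

definition Darboux_wreath ::
  "(real^3) net \<Rightarrow> (real^3) net \<Rightarrow> (real^3) net \<Rightarrow> (real^3) net \<Rightarrow> (real^3) net \<Rightarrow>
   (real^3) net \<Rightarrow> (real^3) net \<Rightarrow> bool" where
  "Darboux_wreath F V LV LB Cbar LC Bbar \<longleftrightarrow>
     LV = L_net V \<and> LB = nu_Q F \<and> Cbar = nu_Q LV \<and>
     A_net LC \<and> reciprocal_parallel LC F \<and> top_net LC = top_net Cbar \<and>
     Bbar = nu_A LC"

end

theory Submission
  imports Defs
begin

text \<open>
  Metric duality is a polarity: writing \<open>area p q\<close> for the determinant of the top views, a point
  \<open>q\<close> lies on \<open>nu_point p\<close> if and only if \<open>q$3 = p$3 + area p q\<close>, and this relation is symmetric.
  So if a Q-net \<open>F\<close> has dual \<open>N\<close>, the edge of \<open>N\<close> between two adjacent faces of \<open>F\<close> is a vector \<open>x\<close> with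
  \<open>x$3 = area q x\<close> for both common vertices \<open>q\<close>. Such vectors form one line through 0, which
  depends only on the line carrying the common edge in the top view, and whose top view has
  the direction of that line.

  For an isotropic V-net all edges along a parameter line lie on one line in the top view, so all dual
  edges across it are multiples of one vector: \<open>E i\<close> for one family, \<open>H j\<close> for the other. As \<open>E i\<close> and
  \<open>H j\<close> have independent top views, the closing condition of a dual quadrilateral makes it a
  parallelogram (\<open>V_net_dual_steps\<close>). Hence \<open>nu_Q F\<close> is translational with steps
  \<open>d i = a i *\<^sub>R E i\<close> and \<open>c j = b j *\<^sub>R H j\<close>; the isotropic dihedral angles are the lengths of
  the top views of these steps, and so are constant along parameter lines.

  An infinitesimal flexion turns \<open>L V\<close> into a Q-net with the same top view, so its dual has steps
  \<open>a' i *\<^sub>R E i\<close> and \<open>b' j *\<^sub>R H j\<close> with the same \<open>E\<close>, \<open>H\<close>. The mixed area of corresponding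
  parallelograms vanishes iff \<open>a i * b' j + a' i * b j = 0\<close>. Separating the variables gives one number
  \<open>l\<close> with \<open>a' i = l * a i\<close> and \<open>b' j = - l * b j\<close> (\<open>flexible_V_net_dual_steps\<close>). Two
  parallelogram nets whose steps are related by \<open>l\<close> and \<open>- l\<close> are Combescure transforms with
  the roles of the diagonals interchanged, that is, Koenigs duals (\<open>Koenigs_dual_if_steps\<close>).

  A net that is reciprocal parallel to a Q-net \<open>F\<close> has each of its vertex stars parallel to a face plane
  of \<open>F\<close>. So it is an A-net, and its dual has the same top view as the dual of \<open>F\<close>
  (\<open>reciprocal_parallel_imp_A_net\<close>). Conversely, a lift of a reciprocal diagram of \<open>F\<close> is reciprocal
  parallel as soon as its edges have the slopes of the face planes of \<open>F\<close>
  (\<open>reciprocal_parallel_lift\<close>). For the top view of \<open>nu_Q (L V)\<close> this prescribes the differences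
  of the heights, and the steps \<open>l *\<^sub>R d i\<close>, \<open>- l *\<^sub>R c j\<close> make these differences integrable; this
  yields \<open>LC\<close>. By the polarity the edges of the dual of \<open>LC\<close> have the slopes of the
  face planes of \<open>L V\<close>, so the same criterion applies to \<open>Bbar\<close>.
\<close>

section \<open>Incidence and direction vectors\<close>

text \<open>The determinant of the top views. It is kept on \<open>real^3\<close> so that the incidence relation of the
  metric duality can be written without projections.\<close>

definition area :: "real^3 \<Rightarrow> real^3 \<Rightarrow> real" where
  "area p q = p$1 * q$2 - p$2 * q$1"

lemma vec2_eq_iff: "(x::real^2) = y \<longleftrightarrow> x$1 = y$1 \<and> x$2 = y$2"
  by (simp add: vec_eq_iff forall_2)

lemma vec3_eq_iff: "(x::real^3) = y \<longleftrightarrow> x$1 = y$1 \<and> x$2 = y$2 \<and> x$3 = y$3"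
  by (simp add: vec_eq_iff forall_3)

lemma top_view_nth [simp]: "top_view p $ 1 = p $ 1" "top_view p $ 2 = p $ 2"
  by (simp_all add: top_view_def)

lemma top_view_eq_iff: "top_view p = top_view q \<longleftrightarrow> p$1 = q$1 \<and> p$2 = q$2"
  by (simp add: vec2_eq_iff)

lemma top_view_diff: "top_view (p - q) = top_view p - top_view q"
  by (simp add: vec2_eq_iff)

lemma top_view_add: "top_view (p + q) = top_view p + top_view q"
  by (simp add: vec2_eq_iff)

lemma top_view_scaleR: "top_view (a *\<^sub>R p) = a *\<^sub>R top_view p"
  by (simp add: vec2_eq_iff)

lemma area_diff_left: "area (p - q) r = area p r - area q r"
  and area_diff_right: "area r (p - q) = area r p - area r q"
  and area_add_right: "area r (p + q) = area r p + area r q"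
  and area_add_left: "area (p + q) r = area p r + area q r"
  and area_scaleR_left: "area (a *\<^sub>R p) q = a * area p q"
  and area_scaleR_right: "area p (a *\<^sub>R q) = a * area p q"
  by (simp_all add: area_def algebra_simps)

lemma area_swap: "area q p = - area p q"
  by (simp add: area_def)

lemma area_self [simp]: "area p p = 0"
  and area_zero [simp]: "area 0 p = 0" "area p 0 = 0"
  and area_minus [simp]: "area (- p) q = - area p q" "area p (- q) = - area p q"
  by (simp_all add: area_def)

lemma area_top_view_cong:
  assumes "top_view p = top_view p'" "top_view q = top_view q'"
  shows "area p q = area p' q'"
  using assms by (simp add: area_def top_view_eq_iff)

lemma area_0_imp_proportional:
  assumes "area x y = 0" "top_view y \<noteq> 0"
  obtains s where "top_view x = s *\<^sub>R top_view y"
proof (cases "y$1 = 0")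
  case True
  with assms have "top_view x = (x$2 / y$2) *\<^sub>R top_view y"
    by (auto simp: area_def vec2_eq_iff)
  then show ?thesis by (rule that)
next
  case False
  with assms have "top_view x = (x$1 / y$1) *\<^sub>R top_view y"
    by (auto simp: area_def vec2_eq_iff field_simps)
  then show ?thesis by (rule that)
qed

lemma area_0_trans:
  assumes "area x e = 0" "area y e = 0" "top_view e \<noteq> 0"
  shows "area x y = 0"
proof -
  obtain s where "top_view x = s *\<^sub>R top_view e"
    using area_0_imp_proportional[OF assms(1,3)] .
  then have "area x y = area (s *\<^sub>R e) y"
    by (intro area_top_view_cong) (simp_all add: top_view_scaleR)
  also have "\<dots> = 0"
    using assms(2) by (simp add: area_scaleR_left area_swap[of e y])
  finally show ?thesis .
qed

text \<open>A vector parallel to a non-vertical plane is determined by its top view, so that proportional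
  top views suffice. The height \<open>area n x\<close> describes both the directions of the plane \<open>nu_point n\<close> and,
  by symmetry of incidence, the differences of the duals of planes through \<open>n\<close>.\<close>
lemma proportional_if_same_slope:
  assumes "x$3 = area n x" "y$3 = area n y" "area x y = 0" "y \<noteq> 0"
  obtains s where "x = s *\<^sub>R y"
proof -
  have y: "top_view y \<noteq> 0"
    using assms(2,4) by (auto simp: vec3_eq_iff vec2_eq_iff area_def)
  obtain s where s: "top_view x = s *\<^sub>R top_view y"
    using area_0_imp_proportional[OF assms(3) y] .
  have "x$3 = area n (s *\<^sub>R y)"
    unfolding assms(1) by (rule area_top_view_cong) (simp_all add: s top_view_scaleR)
  with s assms(2) have "x = s *\<^sub>R y"
    by (simp add: vec3_eq_iff vec2_eq_iff area_scaleR_right)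
  then show ?thesis by (rule that)
qed

lemma parallel_iff: "parallel a b \<longleftrightarrow> a \<noteq> 0 \<and> b \<noteq> 0 \<and> (\<exists>s. a = s *\<^sub>R b)"
  unfolding parallel_def using collinear_lemma[of b a]
  by (auto simp: insert_commute)

lemma parallelE:
  assumes "parallel a b"
  obtains s where "a = s *\<^sub>R b" "s \<noteq> 0"
  using assms unfolding parallel_iff by (metis scaleR_zero_left)

lemma parallel_scaleR_right: "a \<noteq> 0 \<Longrightarrow> s \<noteq> 0 \<Longrightarrow> parallel a (s *\<^sub>R a)"
  by (auto simp: parallel_iff intro!: exI[of _ "inverse s"])

lemma parallel_if_same_slope:
  assumes "x$3 = area n x" "y$3 = area n y" "area x y = 0" "x \<noteq> 0" "y \<noteq> 0"
  shows "parallel x y"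
  using proportional_if_same_slope[OF assms(1,2,3,5)] assms(4,5) by (auto simp: parallel_iff)

lemma parallel_top_view_iff:
  "parallel (top_view x) (top_view y) \<longleftrightarrow>
     top_view x \<noteq> 0 \<and> top_view y \<noteq> 0 \<and> area x y = 0"
proof
  assume "parallel (top_view x) (top_view y)"
  then obtain s where "top_view x = s *\<^sub>R top_view y" "top_view x \<noteq> 0" "top_view y \<noteq> 0"
    by (auto simp: parallel_iff)
  then show "top_view x \<noteq> 0 \<and> top_view y \<noteq> 0 \<and> area x y = 0"
    by (simp add: area_def vec2_eq_iff)
next
  assume "top_view x \<noteq> 0 \<and> top_view y \<noteq> 0 \<and> area x y = 0"
  then show "parallel (top_view x) (top_view y)"
    by (metis area_0_imp_proportional parallel_iff)
qed


section \<open>Metric duality\<close>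

lemma mem_nu_point: "q \<in> nu_point p \<longleftrightarrow> q$3 = p$3 + area p q"
  by (auto simp: nu_point_def area_def algebra_simps)

lemma nu_point_symmetric: "q \<in> nu_point p \<longleftrightarrow> p \<in> nu_point q"
  by (auto simp: mem_nu_point area_swap[of q p])

lemma nu_point_eq_graph_plane: "nu_point p = graph_plane (- p$2) (p$1) (p$3)"
  by (auto simp: nu_point_def graph_plane_def algebra_simps)

lemma non_vertical_plane_iff: "non_vertical_plane P \<longleftrightarrow> (\<exists>p. P = nu_point p)"
proof
  assume "non_vertical_plane P"
  then obtain u v w where "P = graph_plane u v w"
    by (auto simp: non_vertical_plane_def)
  then have "P = nu_point (vector [v, - u, w])"
    by (simp add: nu_point_eq_graph_plane)
  then show "\<exists>p. P = nu_point p" ..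
qed (auto simp: non_vertical_plane_def nu_point_eq_graph_plane)

lemma graph_plane_eq_iff:
  "graph_plane u v w = graph_plane u' v' w' \<longleftrightarrow> u = u' \<and> v = v' \<and> w = w'"
proof
  assume eq: "graph_plane u v w = graph_plane u' v' w'"
  have "vector [x, y, u * x + v * y + w] \<in> graph_plane u v w" for x y :: real
    by (simp add: graph_plane_def)
  then have *: "u * x + v * y + w = u' * x + v' * y + w'" for x y
    unfolding eq by (simp add: graph_plane_def)
  show "u = u' \<and> v = v' \<and> w = w'"
    using *[of 0 0] *[of 1 0] *[of 0 1] by simp
qed simp

lemma nu_point_inject: "nu_point p = nu_point q \<longleftrightarrow> p = q"
  by (auto simp: nu_point_eq_graph_plane graph_plane_eq_iff vec3_eq_iff)

lemma nu_plane_nu_point [simp]: "nu_plane (nu_point p) = p"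
  by (simp add: nu_plane_def nu_point_inject)

text \<open>The top view of the dual point is the gradient of the plane turned by a right angle.\<close>
lemma isotropic_angle_nu_point:
  "isotropic_angle (nu_point p) (nu_point q) = norm (top_view (p - q))"
proof -
  have "isotropic_angle (nu_point p) (nu_point q) = sqrt ((p$2 - q$2)\<^sup>2 + (p$1 - q$1)\<^sup>2)"
    unfolding isotropic_angle_def nu_point_eq_graph_plane
    by (rule the_equality) (auto simp: graph_plane_eq_iff power2_commute intro!: exI)
  then show ?thesis
    by (simp add: norm_vec_def L2_set_def sum_2 add.commute)
qed

lemma nu_point_diff:
  assumes "q \<in> nu_point p" "q' \<in> nu_point p"
  shows "(q - q')$3 = area p (q - q')"
  using assms by (simp add: mem_nu_point area_diff_right)

lemma nu_point_diff_dual: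
  assumes "q \<in> nu_point p" "q \<in> nu_point p'"
  shows "(p - p')$3 = area q (p - p')"
  using assms nu_point_diff nu_point_symmetric by blast

lemma affine_nu_point: "affine (nu_point p)"
proof -
  have "nu_point p = {q. vector [p$2, - p$1, 1] \<bullet> q = p$3}"
    by (auto simp: nu_point_def inner_vec_def sum_3)
  then show ?thesis by (simp add: affine_hyperplane)
qed

text \<open>Cramer's rule in the top view expresses every point of the plane in the affine frame
  \<open>a\<close>, \<open>b\<close>, \<open>c\<close>; the heights agree because the three direction vectors have the slope of the plane.\<close>
lemma affine_hull_eq_nu_point:
  assumes "S \<subseteq> nu_point p" "a \<in> S" "b \<in> S" "c \<in> S" "area (b - a) (c - a) \<noteq> 0"
  shows "affine hull S = nu_point p"
proof
  show "affine hull S \<subseteq> nu_point p"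
    using assms(1) affine_nu_point by (rule hull_minimal)
  show "nu_point p \<subseteq> affine hull S"
  proof
    fix q assume q: "q \<in> nu_point p"
    let ?D = "area (b - a) (c - a)"
    define s where "s = area (q - a) (c - a) / ?D"
    define t where "t = area (b - a) (q - a) / ?D"
    have s: "s * ?D = area (q - a) (c - a)" and t: "t * ?D = area (b - a) (q - a)"
      using assms(5) by (simp_all add: s_def t_def)
    have "?D * (q - a)$1 = ?D * (s * (b - a)$1 + t * (c - a)$1)"
      "?D * (q - a)$2 = ?D * (s * (b - a)$2 + t * (c - a)$2)"
      using arg_cong2[OF s t, of "\<lambda>s t. s * (b - a)$1 + t * (c - a)$1"]
        arg_cong2[OF s t, of "\<lambda>s t. s * (b - a)$2 + t * (c - a)$2"]
      by (simp_all add: area_def algebra_simps)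
    then have 12: "(q - a)$1 = s * (b - a)$1 + t * (c - a)$1"
      "(q - a)$2 = s * (b - a)$2 + t * (c - a)$2"
      using assms(5) by simp_all
    have "a \<in> nu_point p" "b \<in> nu_point p" "c \<in> nu_point p"
      using assms(1-4) by auto
    then have 3: "(q - a)$3 = area p (q - a)" "(b - a)$3 = area p (b - a)"
      "(c - a)$3 = area p (c - a)"
      using q by (blast intro: nu_point_diff)+
    have "(q - a)$3 = s * (b - a)$3 + t * (c - a)$3"
      unfolding 3 area_def 12 by algebra
    with 12 have "q = (1 - s - t) *\<^sub>R a + s *\<^sub>R b + t *\<^sub>R c"
      by (simp add: vec3_eq_iff algebra_simps)
    moreover have "(1 - s - t) *\<^sub>R a + s *\<^sub>R b + t *\<^sub>R c \<in> affine hull {a, b, c}"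
      unfolding affine_hull_3 by (intro CollectI exI conjI) auto
    moreover have "affine hull {a, b, c} \<subseteq> affine hull S"
      using assms(2-4) by (intro hull_mono) auto
    ultimately show "q \<in> affine hull S" by auto
  qed
qed

lemma collinear_nu_point_iff:
  assumes "a \<in> nu_point p" "b \<in> nu_point p" "c \<in> nu_point p"
  shows "collinear {a, b, c} \<longleftrightarrow> area (b - a) (c - b) = 0"
proof -
  have "collinear {a, b, c} \<longleftrightarrow> collinear {0, a - b, c - b}"
    by (rule collinear_3) (simp add: NO_MATCH_def)
  also have "\<dots> \<longleftrightarrow> a - b = 0 \<or> c - b = 0 \<or> (\<exists>s. c - b = s *\<^sub>R (a - b))"
    by (rule collinear_lemma)
  also have "\<dots> \<longleftrightarrow> area (b - a) (c - b) = 0" (is "?l \<longleftrightarrow> ?r")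
  proof
    assume ?l
    then have "area (a - b) (c - b) = 0"
      by (auto simp: area_scaleR_right)
    then show ?r by (simp add: area_diff_left)
  next
    assume ?r
    then have "area (c - b) (a - b) = 0"
      by (simp add: area_diff_left area_diff_right area_swap[of c] area_swap[of b a])
    then show ?l
      using proportional_if_same_slope[of "c - b" p "a - b"] nu_point_diff assms by metis
  qed
  finally show ?thesis .
qed


section \<open>Dual nets of Q-nets and A-nets\<close>

lemma all_less_4_iff: "(\<forall>k<4::nat. P k) \<longleftrightarrow> P 0 \<and> P 1 \<and> P 2 \<and> P 3"
  by (auto simp: less_Suc_eq numeral_eq_Suc)

lemma corner_simps [simp]:
  "corner F i j 0 = F i j" "corner F i j (Suc 0) = F (i+1) j"
  "corner F i j 2 = F (i+1) (j+1)" "corner F i j (Suc (Suc 0)) = F (i+1) (j+1)"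
  "corner F i j 3 = F i (j+1)" "corner F i j (Suc (Suc (Suc 0))) = F i (j+1)"
  by (simp_all add: corner_def numeral_eq_Suc)

lemma Q_netI:
  assumes inc: "\<And>i j. F i j \<in> nu_point (N i j) \<and> F (i+1) j \<in> nu_point (N i j) \<and>
      F (i+1) (j+1) \<in> nu_point (N i j) \<and> F i (j+1) \<in> nu_point (N i j)"
    and nondeg: "\<And>i j k. k < 4 \<Longrightarrow>
      area (corner F i j ((k+1) mod 4) - corner F i j k)
        (corner F i j ((k+2) mod 4) - corner F i j ((k+1) mod 4)) \<noteq> 0"
  shows "Q_net F" and "nu_Q F = N"
proof -
  have inc': "\<forall>k<4. corner F i j k \<in> nu_point (N i j)" for i j
    using inc[of i j] by (simp add: all_less_4_iff)
  have plane: "face_plane F i j = nu_point (N i j)" for i j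
    unfolding face_plane_def
  proof (rule affine_hull_eq_nu_point)
    show "corner F i j ` {..<4} \<subseteq> nu_point (N i j)"
      using inc' by auto
    show "area (corner F i j 1 - corner F i j 0) (corner F i j 2 - corner F i j 0) \<noteq> 0"
      using nondeg[of 0 i j] by (simp add: area_diff_right area_diff_left area_def algebra_simps)
  qed (rule imageI, simp)+
  show "nu_Q F = N"
    by (simp add: nu_Q_def plane)
  have "nondegenerate_face F i j" for i j
    unfolding nondegenerate_face_def
  proof (intro allI impI)
    fix k :: nat assume k: "k < 4"
    have "corner F i j k \<in> nu_point (N i j)" "corner F i j ((k+1) mod 4) \<in> nu_point (N i j)"
      "corner F i j ((k+2) mod 4) \<in> nu_point (N i j)"
      using k inc' by simp_all
    then show "\<not> collinear {corner F i j k, corner F i j ((k+1) mod 4), corner F i j ((k+2) mod 4)}"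
      using nondeg[OF k] collinear_nu_point_iff by blast
  qed
  then show "Q_net F"
    by (auto simp: Q_net_def plane non_vertical_plane_iff)
qed

lemma face_plane_eq_nu_point: "Q_net F \<Longrightarrow> face_plane F i j = nu_point (nu_Q F i j)"
  unfolding Q_net_def non_vertical_plane_iff nu_Q_def by (metis nu_plane_nu_point)

lemma Q_net_corner_mem:
  assumes "Q_net F" "k < 4"
  shows "corner F i j k \<in> nu_point (nu_Q F i j)"
  unfolding face_plane_eq_nu_point[OF assms(1), symmetric] face_plane_def
  using assms(2) by (auto intro: hull_inc)

lemma Q_net_vertex_mem:
  assumes "Q_net F"
  shows "F i j \<in> nu_point (nu_Q F i j)" "F i j \<in> nu_point (nu_Q F (i-1) j)"
    "F i j \<in> nu_point (nu_Q F i (j-1))" "F i j \<in> nu_point (nu_Q F (i-1) (j-1))"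
  using Q_net_corner_mem[OF assms, of 0 i j] Q_net_corner_mem[OF assms, of 1 "i-1" j]
    Q_net_corner_mem[OF assms, of 3 i "j-1"] Q_net_corner_mem[OF assms, of 2 "i-1" "j-1"]
  by simp_all

lemma Q_net_area_nonzero:
  assumes "Q_net F" "k < 4"
  shows "area (corner F i j ((k+1) mod 4) - corner F i j k)
    (corner F i j ((k+2) mod 4) - corner F i j ((k+1) mod 4)) \<noteq> 0"
proof -
  have "\<not> collinear {corner F i j k, corner F i j ((k+1) mod 4), corner F i j ((k+2) mod 4)}"
    using assms by (auto simp: Q_net_def nondegenerate_face_def)
  moreover have "corner F i j k \<in> nu_point (nu_Q F i j)"
    "corner F i j ((k+1) mod 4) \<in> nu_point (nu_Q F i j)"
    "corner F i j ((k+2) mod 4) \<in> nu_point (nu_Q F i j)"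
    using assms by (simp_all add: Q_net_corner_mem)
  ultimately show ?thesis
    using collinear_nu_point_iff by blast
qed

lemma Q_net_edges:
  assumes "Q_net F"
  shows "area (F (i+1) j - F i j) (F i (j+1) - F i j) \<noteq> 0"
    and "top_view (F (i+1) j - F i j) \<noteq> 0" "top_view (F i (j+1) - F i j) \<noteq> 0"
proof -
  show *: "area (F (i+1) j - F i j) (F i (j+1) - F i j) \<noteq> 0"
  proof -
    have "area (F i j - F i (j+1)) (F (i+1) j - F i j) \<noteq> 0"
      using Q_net_area_nonzero[OF assms, of 3 i j] by simp
    then show ?thesis by (simp add: area_def algebra_simps)
  qed
  from * show "top_view (F (i+1) j - F i j) \<noteq> 0" "top_view (F i (j+1) - F i j) \<noteq> 0"
    by (auto simp: area_def vec2_eq_iff)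
qed

text \<open>The edge joining the duals of two planes is, in the top view, parallel to the line in which the
  planes meet: their difference in height vanishes at \<open>q\<close> and at \<open>q'\<close>, and it is linear in between.\<close>
lemma dual_edge:
  assumes "q \<in> nu_point p" "q \<in> nu_point p'" "q' \<in> nu_point p" "q' \<in> nu_point p'"
  shows "area (p - p') (q' - q) = 0"
  using nu_point_diff_dual[OF assms(1,2)] nu_point_diff_dual[OF assms(3,4)]
  by (simp add: area_diff_right area_swap[of "p - p'"])

text \<open>Two distinct planes with a common point have distinct gradients, so the edges of the dual net do
  not collapse in the top view.\<close>
lemma reciprocal_diagram_nu_Q:
  assumes "Q_net F" "edges_nonzero (nu_Q F)"
  shows "reciprocal_diagram (top_net (nu_Q F)) (top_net F)"
proof -
  let ?N = "nu_Q F"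
  note mem = Q_net_vertex_mem[OF assms(1)]
  have ne: "?N i j - ?N (i-1) j \<noteq> 0" "?N i j - ?N i (j-1) \<noteq> 0" for i j
    using assms(2) unfolding edges_nonzero_def by (metis diff_add_cancel right_minus_eq)+
  have top_ne: "top_view (p - p') \<noteq> 0"
    if "p - p' \<noteq> 0" "q \<in> nu_point p" "q \<in> nu_point p'" for p p' q
    using nu_point_diff_dual[OF that(2,3)] that(1)
    by (auto simp: area_def vec3_eq_iff vec2_eq_iff)
  have "area (?N i j - ?N (i-1) j) (F i (j+1) - F i j) = 0"
    "area (?N i j - ?N i (j-1)) (F (i+1) j - F i j) = 0" for i j
    using mem[of i j] mem[of i "j+1"] mem[of "i+1" j] by (simp_all add: dual_edge)
  moreover have "top_view (?N i j - ?N (i-1) j) \<noteq> 0" "top_view (?N i j - ?N i (j-1)) \<noteq> 0" for i j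
    using top_ne[OF ne(1) mem(1,2)] top_ne[OF ne(2) mem(1,3)] .
  ultimately show ?thesis
    unfolding reciprocal_diagram_def reciprocal_parallel_def top_net_def top_view_diff[symmetric]
      parallel_top_view_iff
    using Q_net_edges(2,3)[OF assms(1)] by simp
qed

lemma star_plane_eq_nu_point: "A_net G \<Longrightarrow> star_plane G i j = nu_point (nu_A G i j)"
  unfolding A_net_def non_vertical_plane_iff nu_A_def by (metis nu_plane_nu_point)

lemma A_net_star_mem:
  assumes "A_net G"
  shows "G i j \<in> nu_point (nu_A G i j)" "G i j \<in> nu_point (nu_A G (i-1) j)"
    "G i j \<in> nu_point (nu_A G i (j-1))"
  unfolding star_plane_eq_nu_point[OF assms, symmetric] star_plane_def
  by (rule hull_inc, simp)+

text \<open>The four edges of \<open>G\<close> at \<open>G i j\<close> are parallel to the four edges of the face \<open>(i, j)\<close> of \<open>F\<close>. Hence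
  the star of \<open>G i j\<close> lies in the parallel of that face plane through \<open>G i j\<close>.\<close>
lemma reciprocal_parallel_imp_A_net:
  assumes "Q_net F" "reciprocal_parallel G F"
  shows "A_net G" and "top_net (nu_A G) = top_net (nu_Q F)"
proof -
  \<comment> \<open>The dual of the plane through \<^term>\<open>G i j\<close> that is parallel to the face plane.\<close>
  define p :: "int \<Rightarrow> int \<Rightarrow> real^3" where
    "p i j = vector [nu_Q F i j $ 1, nu_Q F i j $ 2, G i j $ 3 - area (nu_Q F i j) (G i j)]" for i j
  have top_p: "top_view (p i j) = top_view (nu_Q F i j)" for i j
    by (simp add: p_def vec2_eq_iff)
  have centre: "G i j \<in> nu_point (p i j)" for i j
    by (simp add: mem_nu_point p_def area_def)
  have neighbour: "G i j + s *\<^sub>R (q - q') \<in> nu_point (p i j)"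
    if "q \<in> nu_point (nu_Q F i j)" "q' \<in> nu_point (nu_Q F i j)" for i j s q q'
  proof -
    have "(q - q')$3 = area (p i j) (q - q')"
      using nu_point_diff[OF that] area_top_view_cong[OF top_p refl] by metis
    then have "(s *\<^sub>R (q - q'))$3 = area (p i j) (s *\<^sub>R (q - q'))"
      by (simp only: area_scaleR_right vector_scaleR_component real_scaleR_def)
    with centre[of i j] show ?thesis
      by (simp add: mem_nu_point area_add_right)
  qed
  note mem = Q_net_vertex_mem[OF assms(1)]
  have "star_plane G i j = nu_point (p i j)" for i j
  proof -
    have par: "parallel (G i j - G (i-1) j) (F i (j+1) - F i j)"
      "parallel (G (i+1) j - G i j) (F (i+1) (j+1) - F (i+1) j)"
      "parallel (G i j - G i (j-1)) (F (i+1) j - F i j)"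
      "parallel (G i (j+1) - G i j) (F (i+1) (j+1) - F i (j+1))"
      using assms(2) unfolding reciprocal_parallel_def by (metis add_diff_cancel_right')+
    obtain s where s: "G i j - G (i-1) j = s *\<^sub>R (F i (j+1) - F i j)" "s \<noteq> 0"
      using par(1) by (auto elim: parallelE)
    obtain s' where s': "G (i+1) j - G i j = s' *\<^sub>R (F (i+1) (j+1) - F (i+1) j)"
      using par(2) by (auto simp: parallel_iff)
    obtain t where t: "G i j - G i (j-1) = t *\<^sub>R (F (i+1) j - F i j)" "t \<noteq> 0"
      using par(3) by (auto elim: parallelE)
    obtain t' where t': "G i (j+1) - G i j = t' *\<^sub>R (F (i+1) (j+1) - F i (j+1))"
      using par(4) by (auto simp: parallel_iff)
    have nbrs: "G (i-1) j = G i j + s *\<^sub>R (F i j - F i (j+1))"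
      "G (i+1) j = G i j + s' *\<^sub>R (F (i+1) (j+1) - F (i+1) j)"
      "G i (j-1) = G i j + t *\<^sub>R (F i j - F (i+1) j)"
      "G i (j+1) = G i j + t' *\<^sub>R (F (i+1) (j+1) - F i (j+1))"
      using s(1) s' t(1) t' by (simp_all add: algebra_simps)
    show ?thesis
      unfolding star_plane_def
    proof (rule affine_hull_eq_nu_point[of _ _ "G i j" "G (i-1) j" "G i (j-1)"])
      have "F i j \<in> nu_point (nu_Q F i j)" "F (i+1) j \<in> nu_point (nu_Q F i j)"
        "F (i+1) (j+1) \<in> nu_point (nu_Q F i j)" "F i (j+1) \<in> nu_point (nu_Q F i j)"
        using mem[of i j] mem[of "i+1" j] mem[of "i+1" "j+1"] mem[of i "j+1"] by simp_all
      then show "{G i j, G (i+1) j, G (i-1) j, G i (j+1), G i (j-1)} \<subseteq> nu_point (p i j)"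
        unfolding nbrs using centre neighbour by simp
      have "area (F i j - F i (j+1)) (F i j - F (i+1) j) \<noteq> 0"
        using Q_net_edges(1)[OF assms(1), of i j] by (simp add: area_def algebra_simps)
      then show "area (G (i-1) j - G i j) (G i (j-1) - G i j) \<noteq> 0"
        unfolding nbrs using s(2) t(2) by (simp add: area_scaleR_left area_scaleR_right)
    qed auto
  qed
  then show "A_net G" "top_net (nu_A G) = top_net (nu_Q F)"
    by (auto simp: A_net_def non_vertical_plane_iff nu_A_def top_net_def top_p)
qed

text \<open>Each edge of \<open>G\<close> and its partner in \<open>F\<close> are both parallel to the face plane \<open>(i, j)\<close> of \<open>F\<close>, so being
  parallel in the top view lifts to space.\<close>
lemma reciprocal_parallel_lift:
  assumes "Q_net F" "reciprocal_diagram (top_net G) (top_net F)"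
    and "\<And>i j. (G i j - G (i-1) j)$3 = area (nu_Q F i j) (G i j - G (i-1) j)"
    and "\<And>i j. (G i j - G i (j-1))$3 = area (nu_Q F i j) (G i j - G i (j-1))"
  shows "reciprocal_parallel G F"
proof -
  note mem = Q_net_vertex_mem[OF assms(1)]
  have *: "parallel x y" if "parallel (top_view x) (top_view y)"
    "x$3 = area n x" "y$3 = area n y" for x y n
    by (rule parallel_if_same_slope[OF that(2,3)])
      (use that(1) in \<open>auto simp: parallel_top_view_iff vec2_eq_iff\<close>)
  have "(F i (j+1) - F i j)$3 = area (nu_Q F i j) (F i (j+1) - F i j)"
    "(F (i+1) j - F i j)$3 = area (nu_Q F i j) (F (i+1) j - F i j)" for i j
    by (rule nu_point_diff; use mem[of i j] mem[of "i+1" j] mem[of i "j+1"] in simp)+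
  then show ?thesis
    using assms(2) * assms(3,4)
    unfolding reciprocal_diagram_def reciprocal_parallel_def top_net_def top_view_diff[symmetric]
    by blast
qed


section \<open>Translational nets and their steps\<close>

lemma int_const:
  fixes f :: "int \<Rightarrow> 'a"
  assumes "\<And>i. f i = f (i-1)"
  shows "f i = f 0"
proof (induction i rule: int_induct[where k = 0])
  case (step1 i)
  then show ?case using assms[of "i+1"] by simp
next
  case (step2 i)
  then show ?case using assms[of i] by simp
qed simp

lemma int_antidifference:
  fixes d :: "int \<Rightarrow> real"
  obtains A where "\<And>i. A i - A (i-1) = d i"
proof
  fix i :: int
  let ?A = "\<lambda>i. if i \<ge> 0 then sum d {1..i} else - sum d {i+1..0}"
  consider "i \<ge> 1" | "i = 0" | "i < 0" by linarith
  then show "?A i - ?A (i-1) = d i"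
  proof cases
    case 1
    then have "{1..i} = insert i {1..i-1}" by auto
    with 1 show ?thesis by simp
  next
    case 3
    then have "{i..0} = insert i {i+1..0}" by auto
    with 3 show ?thesis by simp
  qed simp
qed

text \<open>Integrate \<open>q\<close> along each row, starting from an integral of \<open>p\<close> on the row \<open>j = 0\<close>; closedness
  carries the differences \<open>p\<close> from one row to the next.\<close>
lemma int_potential:
  fixes p q :: "int \<Rightarrow> int \<Rightarrow> real"
  assumes closed: "\<And>i j. p i j - p i (j-1) = q i j - q (i-1) j"
  obtains z where "\<And>i j. z i j - z (i-1) j = p i j" "\<And>i j. z i j - z i (j-1) = q i j"
proof -
  obtain S where S: "\<And>i. S i - S (i-1) = p i 0"
    using int_antidifference[of "\<lambda>i. p i 0"] by blast
  have "\<forall>i. \<exists>T. \<forall>j. T j - T (j-1) = q i j"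
    using int_antidifference by metis
  then obtain T where T: "\<And>i j. T i j - T i (j-1) = q i j"
    by metis
  define z where "z i j = S i + T i j - T i 0" for i j
  have 2: "z i j - z i (j-1) = q i j" for i j
    using T[of i j] by (simp add: z_def)
  have "z i j - z (i-1) j - p i j = z i 0 - z (i-1) 0 - p i 0" for i j
  proof (rule int_const)
    fix j show "z i j - z (i-1) j - p i j = z i (j-1) - z (i-1) (j-1) - p i (j-1)"
      using 2[of i j] 2[of "i-1" j] closed[of i j] by linarith
  qed
  moreover have "z i 0 - z (i-1) 0 = p i 0" for i
    using S[of i] by (simp add: z_def)
  ultimately have 1: "z i j - z (i-1) j = p i j" for i j
    by simp
  show ?thesis using that[OF 1 2] .
qed

definition has_steps :: "'a::real_vector net \<Rightarrow> (int \<Rightarrow> 'a) \<Rightarrow> (int \<Rightarrow> 'a) \<Rightarrow> bool" where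
  "has_steps N d c \<longleftrightarrow> (\<forall>i j. N i j - N (i-1) j = d i \<and> N i j - N i (j-1) = c j)"

lemma has_stepsD:
  assumes "has_steps N d c"
  shows "N i j - N (i-1) j = d i" "N i j - N i (j-1) = c j"
    "N (i+1) j = N i j + d (i+1)" "N i (j+1) = N i j + c (j+1)"
proof -
  show *: "N i j - N (i-1) j = d i" "N i j - N i (j-1) = c j" for i j
    using assms by (auto simp: has_steps_def)
  show "N (i+1) j = N i j + d (i+1)" "N i (j+1) = N i j + c (j+1)"
    using *(1)[of "i+1" j] *(2)[of i "j+1"] by (simp_all add: algebra_simps)
qed

lemma has_steps_translational:
  assumes "has_steps N d c"
  shows "translational_net N"
proof -
  note st = has_stepsD[OF assms]
  have "N i j - N i 0 = N 0 j - N 0 0" for i j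
  proof (rule int_const)
    fix i show "N i j - N i 0 = N (i-1) j - N (i-1) 0"
      using st(1)[of i j] st(1)[of i 0] by (simp add: algebra_simps)
  qed
  then have "N i j = N i 0 + (N 0 j - N 0 0)" for i j
    by (metis add.commute diff_add_cancel)
  then show ?thesis
    unfolding translational_net_def by fast
qed

lemma translational_net_top_net: "translational_net N \<Longrightarrow> translational_net (top_net N)"
proof -
  assume "translational_net N"
  then obtain g h where "\<And>i j. N i j = g i + h j"
    by (auto simp: translational_net_def)
  then have "top_net N i j = top_view (g i) + top_view (h j)" for i j
    by (simp add: top_net_def top_view_add)
  then show "translational_net (top_net N)"
    unfolding translational_net_def by fast
qed

lemma translational_imp_Chebyshev:
  assumes "translational_net (top_net G)"
  shows "isotropic_Chebyshev_net G"
proof -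
  obtain g h where "\<And>i j. top_net G i j = g i + h j"
    using assms unfolding translational_net_def by metis
  then show ?thesis
    by (simp add: isotropic_Chebyshev_net_def dist_norm)
qed

lemma dihedral_angles_constant_if_steps:
  assumes "Q_net F" "has_steps (nu_Q F) d c"
  shows "dihedral_angles_constant F"
proof -
  have "norm (top_view (nu_Q F (i-1) j - nu_Q F i j)) = norm (top_view (d i))"
    "norm (top_view (nu_Q F i (j-1) - nu_Q F i j)) = norm (top_view (c j))" for i j
    unfolding top_view_diff has_stepsD(1)[OF assms(2), of i j, symmetric]
      has_stepsD(2)[OF assms(2), of i j, symmetric] by (simp_all add: norm_minus_commute)
  then show ?thesis
    by (simp add: dihedral_angles_constant_def face_plane_eq_nu_point[OF assms(1)]
        isotropic_angle_nu_point)
qed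

text \<open>By symmetry of incidence the duals of the four faces around a vertex of \<open>F\<close> lie in the plane dual to
  that vertex. The vertex belonging to the face \<open>(i, j)\<close> of the dual net is \<open>F (i+1) (j+1)\<close>.\<close>
lemma Q_net_nu_Q:
  assumes "Q_net F" "has_steps (nu_Q F) d c" "\<And>i j. area (d i) (c j) \<noteq> 0"
  shows "Q_net (nu_Q F)"
proof (rule Q_netI(1))
  let ?N = "nu_Q F"
  fix i j
  show "?N i j \<in> nu_point (F (i+1) (j+1)) \<and> ?N (i+1) j \<in> nu_point (F (i+1) (j+1)) \<and>
      ?N (i+1) (j+1) \<in> nu_point (F (i+1) (j+1)) \<and> ?N i (j+1) \<in> nu_point (F (i+1) (j+1))"
    using Q_net_vertex_mem[OF assms(1), of "i+1" "j+1"]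
    by (simp add: nu_point_symmetric[of "F (i+1) (j+1)"])
next
  fix i j :: int and k :: nat assume "k < 4"
  moreover have "\<forall>k<4. area (corner (nu_Q F) i j ((k+1) mod 4) - corner (nu_Q F) i j k)
      (corner (nu_Q F) i j ((k+2) mod 4) - corner (nu_Q F) i j ((k+1) mod 4)) \<noteq> 0"
    using assms(3)[of "i+1" "j+1"]
    by (simp add: all_less_4_iff has_stepsD(3,4)[OF assms(2)] area_diff_left area_diff_right
        area_add_left area_add_right area_swap[of "c _"])
  ultimately show "area (corner (nu_Q F) i j ((k+1) mod 4) - corner (nu_Q F) i j k)
      (corner (nu_Q F) i j ((k+2) mod 4) - corner (nu_Q F) i j ((k+1) mod 4)) \<noteq> 0"
    by blast
qed

text \<open>The diagonals of a parallelogram of \<open>N\<close> are \<open>d + c\<close> and \<open>c - d\<close>, and those of its partner in \<open>N'\<close>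
  are \<open>l (d - c)\<close> and \<open>- l (d + c)\<close>: the opposite signs of the factors interchange them.\<close>
lemma Koenigs_dual_if_steps:
  assumes Q: "Q_net N" "Q_net N'"
    and steps: "has_steps N d c" "has_steps N' (\<lambda>i. l *\<^sub>R d i) (\<lambda>j. - l *\<^sub>R c j)"
    and ne: "\<And>i j. area (d i) (c j) \<noteq> 0" "l \<noteq> 0"
  shows "Koenigs_dual N N'" and "combescure N N'"
proof -
  have nz: "d i \<noteq> 0" "c j \<noteq> 0" "d i + c j \<noteq> 0" "d i - c j \<noteq> 0" for i j
  proof -
    show "d i \<noteq> 0" "c j \<noteq> 0" using ne(1)[of i j] by (auto simp: area_def)
    have "area (d i + c j) (c j) \<noteq> 0" "area (d i - c j) (c j) \<noteq> 0"
      using ne(1)[of i j] by (simp_all add: area_def algebra_simps)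
    then show "d i + c j \<noteq> 0" "d i - c j \<noteq> 0" by auto
  qed
  note st = has_stepsD(3,4)[OF steps(1)] has_stepsD(3,4)[OF steps(2)]
  show "combescure N N'"
    using nz ne(2) parallel_scaleR_right[of "c _" "- l"]
    by (simp add: combescure_def st parallel_scaleR_right)
  have par: "parallel x y" if "y = s *\<^sub>R x" "x \<noteq> 0" "s \<noteq> 0" for x y :: "real^3" and s
    using that by (simp add: parallel_scaleR_right)
  show "Koenigs_dual N N'"
    unfolding Koenigs_dual_def all_less_4_iff
  proof (intro conjI allI Q)
    fix i j
    note nz' = nz(1)[of "i+1"] nz(2)[of "j+1"] nz(3,4)[of "i+1" "j+1"]
    show "parallel (corner N i j ((0+1) mod 4) - corner N i j 0)
        (corner N' i j ((0+1) mod 4) - corner N' i j 0)"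
      by (rule par[of _ l]; use nz' ne(2) in \<open>simp add: st; simp add: algebra_simps\<close>)
    show "parallel (corner N i j ((1+1) mod 4) - corner N i j 1)
        (corner N' i j ((1+1) mod 4) - corner N' i j 1)"
      by (rule par[of _ "- l"]; use nz' ne(2) in \<open>simp add: st; simp add: algebra_simps\<close>)
    show "parallel (corner N i j ((2+1) mod 4) - corner N i j 2)
        (corner N' i j ((2+1) mod 4) - corner N' i j 2)"
      by (rule par[of _ l]; use nz' ne(2) in \<open>simp add: st; simp add: algebra_simps\<close>)
    show "parallel (corner N i j ((3+1) mod 4) - corner N i j 3)
        (corner N' i j ((3+1) mod 4) - corner N' i j 3)"
      by (rule par[of _ "- l"]; use nz' ne(2) in \<open>simp add: st; simp add: algebra_simps\<close>)
    show "parallel (corner N i j 2 - corner N i j 0) (corner N' i j 3 - corner N' i j 1)"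
      by (rule par[of _ "- l"]; use nz' ne(2) in \<open>simp add: st; simp add: algebra_simps\<close>)
    show "parallel (corner N i j 3 - corner N i j 1) (corner N' i j 2 - corner N' i j 0)"
      by (rule par[of _ "- l"]; use nz' ne(2) in \<open>simp add: st; simp add: algebra_simps\<close>)
  qed
qed


section \<open>Isotropic V-nets\<close>

text \<open>The vector \<open>e\<close> spans the line of all differences of duals of planes that meet in a line above
  the one containing the top views of the points \<open>f j\<close>.\<close>
lemma dual_line:
  fixes f :: "int \<Rightarrow> real^3"
  assumes "collinear (range (\<lambda>j. top_view (f j)))" "top_view (f 1 - f 0) \<noteq> 0"
  obtains e where "top_view e \<noteq> 0" "\<And>j. e$3 = area (f j) e" "\<And>j k. area e (f k - f j) = 0"
proof -
  obtain u where "\<forall>x\<in>range (\<lambda>j. top_view (f j)). \<forall>y\<in>range (\<lambda>j. top_view (f j)). \<exists>s. x - y = s *\<^sub>R u"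
    using assms(1) unfolding collinear_def by blast
  then have u: "\<exists>s. top_view (f k - f j) = s *\<^sub>R u" for j k
    by (auto simp: top_view_diff)
  \<comment> \<open>The direction of the line, completed by its moment about the origin.\<close>
  define e :: "real^3" where "e = vector [u$1, u$2, f 0 $ 1 * u$2 - f 0 $ 2 * u$1]"
  have top_e: "top_view e = u"
    by (simp add: e_def vec2_eq_iff)
  have e: "area e (f k - f j) = 0" for j k
  proof -
    obtain s where "top_view (f k - f j) = s *\<^sub>R u" using u by blast
    then have "area e (f k - f j) = area e (s *\<^sub>R e)"
      by (intro area_top_view_cong) (simp_all add: top_view_scaleR top_e)
    then show ?thesis by (simp add: area_scaleR_right)
  qed
  have "e$3 = area (f 0) e" by (simp add: e_def area_def)
  then have "e$3 = area (f j) e" for j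
    using e[of j 0] by (simp add: area_diff_right area_swap[of e])
  moreover have "u \<noteq> 0" using u[of 1 0] assms(2) by auto
  ultimately show ?thesis using that top_e e by blast
qed

lemma dual_edge_proportional:
  assumes "q \<in> nu_point p" "q \<in> nu_point p'" "q' \<in> nu_point p" "q' \<in> nu_point p'"
    and "top_view (q' - q) \<noteq> 0" and "top_view e \<noteq> 0" "e$3 = area q e" "area e (q' - q) = 0"
  obtains s where "p - p' = s *\<^sub>R e"
proof -
  have "area (p - p') e = 0"
    using area_0_trans[OF dual_edge[OF assms(1-4)] assms(8,5)] .
  moreover have "e \<noteq> 0" using assms(6) by (auto simp: vec2_eq_iff)
  ultimately show ?thesis
    using proportional_if_same_slope[OF nu_point_diff_dual[OF assms(1,2)] assms(7)] that by blast
qed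

lemma area_line_directions_nonzero:
  assumes "Q_net F" "top_view e \<noteq> 0" "area e (F i (j+1) - F i j) = 0"
    and "top_view h \<noteq> 0" "area h (F (i+1) j - F i j) = 0"
  shows "area e h \<noteq> 0"
proof
  assume "area e h = 0"
  then have "area (F i (j+1) - F i j) e = 0" "area h e = 0"
    using assms(3) by (simp_all add: area_swap[of _ e])
  then have "area (F i (j+1) - F i j) h = 0"
    using assms(2) by (rule area_0_trans)
  moreover have "area (F (i+1) j - F i j) h = 0"
    using assms(5) by (simp add: area_swap[of _ h])
  ultimately have "area (F (i+1) j - F i j) (F i (j+1) - F i j) = 0"
    using assms(4) by (blast intro: area_0_trans)
  then show False using Q_net_edges(1)[OF assms(1)] by blast
qed

text \<open>The hypotheses on \<open>E\<close> and \<open>H\<close> involve \<open>F\<close> only through its top view, so the same \<open>E\<close> and \<open>H\<close>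
  serve for every Q-net with this top view. The factors become independent of one index because the
  dual quadrilaterals close up and \<open>E i\<close>, \<open>H j\<close> are independent.\<close>
lemma V_net_dual_steps:
  assumes Q: "Q_net F"
    and E: "\<And>i. top_view (E i) \<noteq> 0" "\<And>i j. E i $ 3 = area (F i j) (E i)"
      "\<And>i j. area (E i) (F i (j+1) - F i j) = 0"
    and H: "\<And>j. top_view (H j) \<noteq> 0" "\<And>i j. H j $ 3 = area (F i j) (H j)"
      "\<And>i j. area (H j) (F (i+1) j - F i j) = 0"
  obtains a b where "has_steps (nu_Q F) (\<lambda>i. a i *\<^sub>R E i) (\<lambda>j. b j *\<^sub>R H j)"
proof -
  let ?N = "nu_Q F"
  note mem = Q_net_vertex_mem[OF Q]
  have "\<exists>s. ?N i j - ?N (i-1) j = s *\<^sub>R E i" for i j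
    by (rule dual_edge_proportional[of "F i j" "?N i j" "?N (i-1) j" "F i (j+1)" "E i"])
      (use mem[of i j] mem[of i "j+1"] Q_net_edges[OF Q] E in auto)
  then obtain a where a: "\<And>i j. ?N i j - ?N (i-1) j = a i j *\<^sub>R E i"
    by metis
  have "\<exists>s. ?N i j - ?N i (j-1) = s *\<^sub>R H j" for i j
    by (rule dual_edge_proportional[of "F i j" "?N i j" "?N i (j-1)" "F (i+1) j" "H j"])
      (use mem[of i j] mem[of "i+1" j] Q_net_edges[OF Q] H in auto)
  then obtain b where b: "\<And>i j. ?N i j - ?N i (j-1) = b i j *\<^sub>R H j"
    by metis
  have EH: "area (E i) (H j) \<noteq> 0" for i j
    by (rule area_line_directions_nonzero[OF Q, where i = i and j = j]) (fact E H)+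
  have closed: "(a i j - a i (j-1)) *\<^sub>R E i = (b i j - b (i-1) j) *\<^sub>R H j" for i j
  proof -
    have "a i j *\<^sub>R E i - a i (j-1) *\<^sub>R E i = b i j *\<^sub>R H j - b (i-1) j *\<^sub>R H j"
      unfolding a[symmetric] b[symmetric] by simp
    then show ?thesis by (simp add: scaleR_diff_left)
  qed
  have "a i j = a i (j-1)" for i j
    using arg_cong[OF closed[of i j], of "\<lambda>x. area x (H j)"] EH[of i j]
    by (simp add: area_scaleR_left)
  then have a0: "a i j = a i 0" for i j by (rule int_const)
  have "b i j = b (i-1) j" for i j
    using arg_cong[OF closed[of i j], of "\<lambda>x. area (E i) x"] EH[of i j]
    by (simp add: area_scaleR_right)
  then have b0: "b i j = b 0 j" for i j by (rule int_const)
  have "has_steps ?N (\<lambda>i. a i 0 *\<^sub>R E i) (\<lambda>j. b 0 j *\<^sub>R H j)"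
    unfolding has_steps_def using a b a0 b0 by metis
  then show ?thesis by (rule that)
qed

text \<open>Mixed area is invariant under translations of either quadrilateral, so only the steps enter.\<close>
lemma mixed_area_steps:
  assumes "has_steps N d c" "has_steps N' d' c'"
  shows "mixed_area (corner (top_net N) i j) (corner (top_net N') i j)
    = (area (d (i+1)) (c' (j+1)) + area (d' (i+1)) (c (j+1))) / 2"
proof -
  have 4: "{..<4::nat} = {0, 1, 2, 3}" by auto
  have *: "det (vector [top_view p, top_view q] :: real^2^2) = area p q" for p q
    by (simp add: det_2 area_def)
  show ?thesis
    by (simp add: mixed_area_def 4 * top_net_def has_stepsD(3,4)[OF assms(1)] has_stepsD(3,4)[OF assms(2)]
      area_add_left area_add_right area_swap[of "N' i j"] area_swap[of "d' (i+1)"] area_swap[of "c' (j+1)"])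
qed


section \<open>Infinitesimal flexions\<close>

text \<open>On each face the third row of the velocity matrix makes the height of \<open>V\<close> an affine function of the top
  view of \<open>F\<close>, which is also the top view of \<open>L V\<close>; so \<open>L V\<close> has planar faces. They inherit
  non-degeneracy from \<open>F\<close> through the common top view.\<close>
lemma Q_net_L_net:
  assumes "infinitesimally_flexible F V"
  shows "Q_net (L_net V)"
proof -
  have Q: "Q_net F" and top: "top_net (L_net V) = top_net F"
    and T: "\<And>i j. \<exists>D c1 c2 c3. \<forall>k<4.
        corner V i j k = D + isotropic_velocity_matrix c1 c2 c3 *v corner F i j k"
    using assms by (auto simp: infinitesimally_flexible_def)
  have top': "top_view (L_net V i j) = top_view (F i j)" for i j
    using fun_cong[OF fun_cong[OF top]] by (simp add: top_net_def)
  have "\<exists>p. \<forall>k<4. corner (L_net V) i j k \<in> nu_point p" for i j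
  proof -
    obtain D c1 c2 c3 where
      V: "\<forall>k<4. corner V i j k = D + isotropic_velocity_matrix c1 c2 c3 *v corner F i j k"
      using T by blast
    then have "\<forall>k<4. corner V i j k $ 3
        = D$3 + c1 * corner F i j k $ 1 + c2 * corner F i j k $ 2"
      by (simp add: isotropic_velocity_matrix_def matrix_vector_mult_def sum_3)
    moreover have "L_net V i' j' \<in> nu_point (vector [- c2, c1, - D$3]) \<longleftrightarrow>
        V i' j' $ 3 = D$3 + c1 * F i' j' $ 1 + c2 * F i' j' $ 2" for i' j'
      using top'[of i' j'] by (auto simp: mem_nu_point area_def L_net_def L_def top_view_eq_iff)
    ultimately show ?thesis
      by (intro exI[of _ "vector [- c2, c1, - D$3]"]) (simp add: all_less_4_iff)
  qed
  then obtain p where p: "\<And>i j. \<forall>k<4. corner (L_net V) i j k \<in> nu_point (p i j)"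
    by metis
  have corner_top: "\<forall>k<4. top_view (corner (L_net V) i j k) = top_view (corner F i j k)" for i j
    by (simp add: all_less_4_iff top')
  show ?thesis
  proof (rule Q_netI(1))
    fix i j
    show "L_net V i j \<in> nu_point (p i j) \<and> L_net V (i+1) j \<in> nu_point (p i j) \<and>
      L_net V (i+1) (j+1) \<in> nu_point (p i j) \<and> L_net V i (j+1) \<in> nu_point (p i j)"
      using p[of i j] by (simp add: all_less_4_iff)
  next
    fix i j :: int and k :: nat assume "k < 4"
    let ?P = "\<lambda>F. area (corner F i j ((k+1) mod 4) - corner F i j k)
        (corner F i j ((k+2) mod 4) - corner F i j ((k+1) mod 4))"
    have "?P (L_net V) = ?P F"
      by (rule area_top_view_cong; unfold top_view_diff; use corner_top \<open>k < 4\<close> in simp)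
    then show "?P (L_net V) \<noteq> 0"
      using Q_net_area_nonzero[OF Q \<open>k < 4\<close>] by simp
  qed
qed

text \<open>The balance equations \<open>a i * b' j + a' i * b j = 0\<close> say that \<open>a' i / a i = - b' j / b j\<close> for all
  \<open>i\<close> and \<open>j\<close>, so both sides are one constant \<open>l\<close>.\<close>
lemma flexible_V_net_dual_steps:
  assumes "isotropic_V_net F" "infinitesimally_flexible F V"
  obtains l d c where "l \<noteq> 0" "\<And>i j. area (d i) (c j) \<noteq> 0" "has_steps (nu_Q F) d c"
    "has_steps (nu_Q (L_net V)) (\<lambda>i. l *\<^sub>R d i) (\<lambda>j. - l *\<^sub>R c j)"
proof -
  let ?LV = "L_net V"
  have Q: "Q_net F" and Q': "Q_net ?LV"
    using assms Q_net_L_net by (auto simp: isotropic_V_net_def)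
  have top: "top_net ?LV = top_net F"
    and mixed: "\<And>i j. mixed_area (corner (top_net (nu_Q F)) i j) (corner (top_net (nu_Q ?LV)) i j) = 0"
    and nz: "edges_nonzero (nu_Q F)" "edges_nonzero (nu_Q ?LV)"
    using assms(2) by (auto simp: infinitesimally_flexible_def)
  have top': "top_view (?LV i j) = top_view (F i j)" for i j
    using fun_cong[OF fun_cong[OF top]] by (simp add: top_net_def)
  have cong: "area (?LV i j) x = area (F i j) x"
    "area x (?LV i j - ?LV i' j') = area x (F i j - F i' j')" for i j i' j' x
    by (rule area_top_view_cong; simp add: top' top_view_diff)+
  have "\<exists>e. top_view e \<noteq> 0 \<and> (\<forall>j. e$3 = area (F i j) e) \<and> (\<forall>j. area e (F i (j+1) - F i j) = 0)" for i
    by (rule dual_line[of "F i"])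
      (use assms(1) Q_net_edges(3)[OF Q, of i 0] in \<open>auto simp: isotropic_V_net_def top_net_def\<close>)
  then obtain E where E: "\<And>i. top_view (E i) \<noteq> 0" "\<And>i j. E i $ 3 = area (F i j) (E i)"
      "\<And>i j. area (E i) (F i (j+1) - F i j) = 0"
    by metis
  have "\<exists>e. top_view e \<noteq> 0 \<and> (\<forall>i. e$3 = area (F i j) e) \<and> (\<forall>i. area e (F (i+1) j - F i j) = 0)" for j
    by (rule dual_line[of "\<lambda>i. F i j"])
      (use assms(1) Q_net_edges(2)[OF Q, of 0 j] in \<open>auto simp: isotropic_V_net_def top_net_def\<close>)
  then obtain H where H: "\<And>j. top_view (H j) \<noteq> 0" "\<And>i j. H j $ 3 = area (F i j) (H j)"
      "\<And>i j. area (H j) (F (i+1) j - F i j) = 0"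
    by metis
  obtain a b where ab: "has_steps (nu_Q F) (\<lambda>i. a i *\<^sub>R E i) (\<lambda>j. b j *\<^sub>R H j)"
    using V_net_dual_steps[OF Q E H] .
  obtain a' b' where ab': "has_steps (nu_Q ?LV) (\<lambda>i. a' i *\<^sub>R E i) (\<lambda>j. b' j *\<^sub>R H j)"
    by (rule V_net_dual_steps[OF Q', of E H]) (simp_all add: cong E H flip: E(2) H(2))
  have steps_nz: "d i \<noteq> 0 \<and> c j \<noteq> 0" if "has_steps N d c" "edges_nonzero N"
    for N :: "(real^3) net" and d c i j
    using that(2)[unfolded edges_nonzero_def, rule_format, of "i-1" "j-1"] has_stepsD(3,4)[OF that(1), of "i-1" "j-1"]
    by auto
  have ne: "a i \<noteq> 0" "b j \<noteq> 0" "a' i \<noteq> 0" "b' j \<noteq> 0" for i j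
    using steps_nz[OF ab nz(1), of i j] steps_nz[OF ab' nz(2), of i j] by auto
  have EH: "area (E i) (H j) \<noteq> 0" for i j
    by (rule area_line_directions_nonzero[OF Q, where i = i and j = j]) (fact E H)+
  have balance: "a i * b' j + a' i * b j = 0" for i j
  proof -
    have "a i * (b' j * area (E i) (H j)) + a' i * (b j * area (E i) (H j)) = 0"
      \<comment> \<open>The steps \<open>i\<close> and \<open>j\<close> are sides of the dual face \<open>(i-1, j-1)\<close>.\<close>
      using mixed[of "i-1" "j-1"] unfolding mixed_area_steps[OF ab ab']
      by (simp add: area_scaleR_left area_scaleR_right mult_ac)
    then have "(a i * b' j + a' i * b j) * area (E i) (H j) = 0"
      by (simp add: algebra_simps)
    then show ?thesis using EH by simp
  qed
  define l where "l = a' 0 / a 0"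
  have b': "b' j = - l * b j" for j
    using balance[of 0 j] ne by (simp add: l_def field_simps eq_neg_iff_add_eq_0 add.commute)
  have a': "a' i = l * a i" for i
    using balance[of i 0] ne(2)[of 0] b'[of 0] by (simp add: algebra_simps)
  show ?thesis
  proof (rule that[of l "\<lambda>i. a i *\<^sub>R E i" "\<lambda>j. b j *\<^sub>R H j"])
    show "l \<noteq> 0" using ne by (simp add: l_def)
    show "has_steps (nu_Q ?LV) (\<lambda>i. l *\<^sub>R a i *\<^sub>R E i) (\<lambda>j. - l *\<^sub>R b j *\<^sub>R H j)"
      using ab' by (simp add: a' b')
  qed (use ab ne EH in \<open>simp_all add: area_scaleR_left area_scaleR_right\<close>)
qed


section \<open>The wreath\<close>

text \<open>The lift of \<open>N'\<close> must have the slopes of the face planes of \<open>F\<close>. The prescribed differences of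
  height are integrable because \<open>area (c j) (l *\<^sub>R d i) = area (d i) (- l *\<^sub>R c j)\<close>; here the
  opposite signs of the factors are essential.\<close>
lemma exists_reciprocal_parallel_lift:
  assumes "Q_net F" and diag: "reciprocal_diagram (top_net N') (top_net F)"
    and steps: "has_steps (nu_Q F) d c" "has_steps N' (\<lambda>i. l *\<^sub>R d i) (\<lambda>j. - l *\<^sub>R c j)"
  obtains G where "reciprocal_parallel G F" "top_net G = top_net N'"
proof -
  let ?N = "nu_Q F"
  have "area (?N i j) (l *\<^sub>R d i) - area (?N i (j-1)) (l *\<^sub>R d i)
      = area (?N i j) (- l *\<^sub>R c j) - area (?N (i-1) j) (- l *\<^sub>R c j)" for i j
    unfolding area_diff_left[symmetric] has_stepsD(1,2)[OF steps(1)]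
    by (simp add: area_scaleR_right area_swap[of "c j"])
  then obtain z where z: "\<And>i j. z i j - z (i-1) j = area (?N i j) (l *\<^sub>R d i)"
    "\<And>i j. z i j - z i (j-1) = area (?N i j) (- l *\<^sub>R c j)"
    using int_potential[of "\<lambda>i j. area (?N i j) (l *\<^sub>R d i)" "\<lambda>i j. area (?N i j) (- l *\<^sub>R c j)"]
    by metis
  define G :: "(real^3) net" where "G i j = vector [N' i j $ 1, N' i j $ 2, z i j]" for i j
  have top: "top_view (G i j) = top_view (N' i j)" for i j
    by (simp add: G_def vec2_eq_iff)
  have "reciprocal_parallel G F"
  proof (rule reciprocal_parallel_lift[OF assms(1)])
    show "reciprocal_diagram (top_net G) (top_net F)"
      using diag by (simp add: top_net_def top)
    fix i j
    have "area (?N i j) (G i j - G (i-1) j) = area (?N i j) (N' i j - N' (i-1) j)"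
      "area (?N i j) (G i j - G i (j-1)) = area (?N i j) (N' i j - N' i (j-1))"
      by (rule area_top_view_cong; simp add: top top_view_diff)+
    then show "(G i j - G (i-1) j)$3 = area (?N i j) (G i j - G (i-1) j)"
      "(G i j - G i (j-1))$3 = area (?N i j) (G i j - G i (j-1))"
      using z by (simp_all add: has_stepsD(1,2)[OF steps(2)] G_def)
  qed
  then show ?thesis using that by (simp add: top_net_def top)
qed

text \<open>A vertex \<open>G i j\<close> lies in its own star plane and in those of its neighbours. Dually, the edges of
  \<open>nu_A G\<close> at \<open>(i, j)\<close> have the slope of the planes \<open>nu_point (G i j)\<close>, which is the slope of the face
  plane \<open>(i, j)\<close> of \<open>F\<close> because \<open>G\<close> and \<open>nu_Q F\<close> have the same top view.\<close>
lemma reciprocal_parallel_nu_A: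
  assumes "A_net G" "Q_net F" "top_net G = top_net (nu_Q F)"
    and diag: "reciprocal_diagram (top_net (nu_A G)) (top_net F)"
  shows "reciprocal_parallel (nu_A G) F"
proof (rule reciprocal_parallel_lift[OF assms(2) diag])
  fix i j
  have "top_view (G i j) = top_view (nu_Q F i j)"
    using fun_cong[OF fun_cong[OF assms(3)]] by (simp add: top_net_def)
  then have "area (G i j) x = area (nu_Q F i j) x" for x
    by (rule area_top_view_cong) simp
  then show "(nu_A G i j - nu_A G (i-1) j)$3 = area (nu_Q F i j) (nu_A G i j - nu_A G (i-1) j)"
    "(nu_A G i j - nu_A G i (j-1))$3 = area (nu_Q F i j) (nu_A G i j - nu_A G i (j-1))"
    using nu_point_diff_dual A_net_star_mem[OF assms(1)] by metis+
qed

theorem proposition64: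
  fixes F V :: "int \<Rightarrow> int \<Rightarrow> real^3"
  assumes "isotropic_V_net F"
    and "infinitesimally_flexible F V"
  shows "(\<exists>LV LB Cbar LC Bbar. Darboux_wreath F V LV LB Cbar LC Bbar) \<and>
    (\<forall>LV LB Cbar LC Bbar. Darboux_wreath F V LV LB Cbar LC Bbar \<longrightarrow>
      \<comment> \<open>(i)\<close>
      (isotropic_V_net F \<and> isotropic_V_net LV \<and> top_net F = top_net LV \<and>
       metric_dual_Koenigs F LV) \<and>
      \<comment> \<open>(ii)\<close>
      (dihedral_angles_constant F \<and> dihedral_angles_constant LV) \<and>
      \<comment> \<open>(iii)\<close>
      (translational_net LB \<and> translational_net Cbar \<and> combescure LB Cbar \<and>
       Koenigs_dual LB Cbar \<and>
       reciprocal_diagram (top_net LB) (top_net F) \<and>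
       reciprocal_diagram (top_net LB) (top_net LV) \<and>
       reciprocal_diagram (top_net Cbar) (top_net F) \<and>
       reciprocal_diagram (top_net Cbar) (top_net LV)) \<and>
      \<comment> \<open>(iv)\<close>
      (reciprocal_parallel LC F \<and> reciprocal_parallel Bbar LV \<and>
       isotropic_K_net LC \<and> isotropic_K_net Bbar \<and>
       A_net LC \<and> A_net Bbar \<and>
       isotropic_Chebyshev_net LC \<and> isotropic_Chebyshev_net Bbar \<and>
       translational_net (top_net LC) \<and> translational_net (top_net Bbar) \<and>
       top_net LC = top_net Cbar \<and> top_net Bbar = top_net LB))"
proof -
  let ?LV = "L_net V"
  have Q: "Q_net F" and Q': "Q_net ?LV"
    using assms Q_net_L_net by (auto simp: isotropic_V_net_def)
  have top: "top_net ?LV = top_net F" and nz: "edges_nonzero (nu_Q F)" "edges_nonzero (nu_Q ?LV)"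
    using assms(2) by (auto simp: infinitesimally_flexible_def)
  have V': "isotropic_V_net ?LV"
    using assms(1) Q' by (simp add: isotropic_V_net_def top)
  obtain l d c where l: "l \<noteq> 0" and dc: "\<And>i j. area (d i) (c j) \<noteq> 0"
    and steps: "has_steps (nu_Q F) d c"
      "has_steps (nu_Q ?LV) (\<lambda>i. l *\<^sub>R d i) (\<lambda>j. - l *\<^sub>R c j)"
    using flexible_V_net_dual_steps[OF assms] by metis
  have trans: "translational_net (nu_Q F)" "translational_net (nu_Q ?LV)"
    using steps by (auto intro: has_steps_translational)
  have "area (l *\<^sub>R d i) (- l *\<^sub>R c j) \<noteq> 0" for i j
    using l dc by (simp add: area_scaleR_left area_scaleR_right)
  then have QN: "Q_net (nu_Q F)" "Q_net (nu_Q ?LV)"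
    using Q_net_nu_Q[OF Q steps(1) dc] Q_net_nu_Q[OF Q' steps(2)] by auto
  note Koenigs = Koenigs_dual_if_steps[OF QN steps dc l]
  have diag: "reciprocal_diagram (top_net (nu_Q F)) (top_net F)"
    "reciprocal_diagram (top_net (nu_Q ?LV)) (top_net F)"
    using reciprocal_diagram_nu_Q[OF Q nz(1)] reciprocal_diagram_nu_Q[OF Q' nz(2)]
    by (simp_all add: top)
  have dihedral: "dihedral_angles_constant F" "dihedral_angles_constant ?LV"
    using dihedral_angles_constant_if_steps Q Q' steps by blast+
  obtain G where G: "reciprocal_parallel G F" "top_net G = top_net (nu_Q ?LV)"
    using exists_reciprocal_parallel_lift[OF Q diag(2) steps] .
  have "Darboux_wreath F V ?LV (nu_Q F) (nu_Q ?LV) G (nu_A G)"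
    unfolding Darboux_wreath_def using G reciprocal_parallel_imp_A_net(1)[OF Q G(1)] by simp
  then have ex: "\<exists>LV LB Cbar LC Bbar. Darboux_wreath F V LV LB Cbar LC Bbar"
    by blast
  have K_nets: "reciprocal_parallel (nu_A LC) ?LV \<and> isotropic_K_net LC \<and>
      isotropic_K_net (nu_A LC) \<and> A_net LC \<and> A_net (nu_A LC) \<and>
      isotropic_Chebyshev_net LC \<and> isotropic_Chebyshev_net (nu_A LC) \<and>
      translational_net (top_net LC) \<and> translational_net (top_net (nu_A LC)) \<and>
      top_net (nu_A LC) = top_net (nu_Q F)"
    if LC: "reciprocal_parallel LC F" "top_net LC = top_net (nu_Q ?LV)" for LC
  proof -
    note A = reciprocal_parallel_imp_A_net[OF Q LC(1)]
    have recip: "reciprocal_parallel (nu_A LC) ?LV"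
      using reciprocal_parallel_nu_A[OF A(1) Q' LC(2)] diag(1) by (simp add: A(2) top)
    have "translational_net (top_net LC)" "translational_net (top_net (nu_A LC))"
      using trans by (simp_all add: LC(2) A(2) translational_net_top_net)
    then show ?thesis
      using A recip reciprocal_parallel_imp_A_net(1)[OF Q' recip]
      by (simp add: isotropic_K_net_def translational_imp_Chebyshev)
  qed
  show ?thesis
    using ex K_nets assms(1) V' dihedral trans trans[THEN translational_net_top_net] Koenigs diag Q Q'
    unfolding Darboux_wreath_def metric_dual_Koenigs_def by (auto simp: top)
qed

end
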